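(* Let $n,m\ge 2$ and let $A_1,\dots,A_m$ be symmetric real $n\times n$ matrices. Then $$\Big(\sum_{r=1}^m\|A_r\|^2\Big)^2\ \ge\ 2\sum_{1\le r<s\le m}\|[A_r,A_s]\|^2 .$$
   Context: For an $n\times n$ real matrix $A=(a_{ij})$, $\|A\|=\big(\sum_{i,j=1}^n a_{ij}^2\big)^{1/2}$ is its Hilbert-Schmidt norm, and $[A,B]=AB-BA$ is the commutator. *)

theory Defs
  imports "HOL-Analysis.Analysis"
begin

definition hs_norm :: "real ^ 'n ^ 'n \<Rightarrow> real"
  where "hs_norm A = sqrt (\<Sum>i\<in>UNIV. \<Sum>j\<in>UNIV. (A $ i $ j)\<^sup>2)"

definition commutator :: "real ^ 'n ^ 'n \<Rightarrow> real ^ 'n ^ 'n \<Rightarrow> real ^ 'n ^ 'n"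
  where "commutator A B = A ** B - B ** A"

(* The library norm on nested vectors is the Hilbert-Schmidt norm, not the operator norm. *)
lemma hs_norm_eq_norm: "hs_norm A = norm A"
  by (simp add: hs_norm_def norm_vec_def L2_set_def sum_nonneg)

end

theory Submission
  imports Defs
begin

text \<open>
  Three observations carry the proof.

  First, the family \<open>A\<close> enters both sides only through quadratic expressions summed over the
  family, so it may be replaced by its principal axes: the operator
  \<open>X \<mapsto> (\<Sum>r. (A r \<bullet> X) A r)\<close> on the space of matrices is self-adjoint, and in terms of an
  orthonormal family \<open>K\<close> of eigenvectors with eigenvalues \<open>t k > 0\<close> the left-hand side
  is \<open>(\<Sum>k. t k)\<^sup>2\<close> and the right-hand side is \<open>\<Sum>k l. t k t l c k l\<close>, where \<open>c k l\<close> is the squared norm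
  of the commutator of \<open>k\<close> and \<open>l\<close> (\<open>principal_axes\<close>, \<open>sum_norm_sq_linear_image\<close>).
  The members of \<open>K\<close> lie in the span of the \<open>A r\<close> and so are symmetric.

  Second, commuting a symmetric unit matrix with the members of a finite orthonormal set \<open>S\<close> of
  symmetric matrices yields a sum of squared norms of at most \<open>card S + 1\<close>
  (\<open>sum_norm_sq_commutator_le\<close>). In an eigenbasis of the unit matrix, with eigenvalues \<open>e u\<close>, this
  sum is \<open>\<Sum>u v. (e u - e v)\<^sup>2 r u v\<close> with weights \<open>r u v \<ge> 0\<close> of total \<open>card S\<close>, and Bessel's
  inequality bounds each weight off the diagonal by \<open>1/2\<close>. Hence only the pairs with
  \<open>\<bar>e u - e v\<bar> > 1\<close> can push the sum above \<open>card S\<close>, and the excess is at most 1 because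
  \<open>\<Sum>(u,v)\<in>P. (e u - e v)\<^sup>2 \<le> (card P + 1) \<Sum>u. (e u)\<^sup>2\<close> for every set \<open>P\<close>
  of pairs ordered by decreasing \<open>e\<close> (\<open>sum_sq_gaps_le\<close>): the largest Laplacian eigenvalue of a graph
  exceeds its number of edges by at most one.

  Third, the second observation, applied to the set of all \<open>l\<close> with \<open>c k l > 1\<close>, says that the
  positive parts of \<open>c k l - 1\<close> have row sums at most 1. By
  \<open>2 t k t l \<le> (t k)\<^sup>2 + (t l)\<^sup>2\<close>, their contribution to the quadratic form is at most
  \<open>\<Sum>k. (t k)\<^sup>2\<close>, which is exactly what the vanishing diagonal \<open>c k k = 0\<close> leaves free in
  \<open>(\<Sum>k. t k)\<^sup>2\<close> (\<open>weighted_sum_le_square\<close>).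
\<close>

section \<open>Orthonormal sets\<close>

definition orthonormal :: "'a::real_inner set \<Rightarrow> bool" where
  "orthonormal U \<longleftrightarrow> (\<forall>u\<in>U. \<forall>v\<in>U. u \<bullet> v = (if u = v then 1 else 0))"

lemma orthonormal_subset: "orthonormal U \<Longrightarrow> V \<subseteq> U \<Longrightarrow> orthonormal V"
  unfolding orthonormal_def by blast

lemma orthonormal_norm: "orthonormal U \<Longrightarrow> u \<in> U \<Longrightarrow> norm u = 1"
  by (simp add: orthonormal_def norm_eq_1)

lemma orthonormal_finite_card:
  fixes U :: "'a::euclidean_space set"
  assumes "orthonormal U"
  shows "finite U" and "card U \<le> DIM('a)"
proof -
  have "pairwise orthogonal U"
    using assms by (auto simp: orthonormal_def pairwise_def orthogonal_def)
  moreover have "0 \<notin> U"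
    using orthonormal_norm[OF assms, of 0] by auto
  ultimately have "independent U"
    by (rule pairwise_orthogonal_independent)
  then show "finite U" "card U \<le> DIM('a)"
    using independent_bound by auto
qed

lemma inner_orthonormal_sum:
  assumes "orthonormal U" "finite U" "u \<in> U"
  shows "(\<Sum>v\<in>U. a v *\<^sub>R v) \<bullet> u = a u"
proof -
  have "(\<Sum>v\<in>U. a v *\<^sub>R v) \<bullet> u = (\<Sum>v\<in>U. if v = u then a v else 0)"
    unfolding inner_sum_left
    by (rule sum.cong) (use assms in \<open>auto simp: orthonormal_def\<close>)
  then show ?thesis using assms by simp
qed

lemma norm_orthonormal_sum:
  assumes "orthonormal U" "finite U"
  shows "(norm (\<Sum>v\<in>U. a v *\<^sub>R v))\<^sup>2 = (\<Sum>v\<in>U. (a v)\<^sup>2)"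
  unfolding power2_norm_eq_inner
  by (subst inner_sum_right)
     (simp add: inner_orthonormal_sum[OF assms] power2_eq_square)

lemma orthonormal_expand:
  assumes "orthonormal U" "finite U" "x \<in> span U"
  shows "x = (\<Sum>u\<in>U. (x \<bullet> u) *\<^sub>R u)"
proof -
  obtain a where a: "x = (\<Sum>u\<in>U. a u *\<^sub>R u)"
    using assms(3) unfolding span_finite[OF assms(2)] by auto
  have "x \<bullet> u = a u" if "u \<in> U" for u
    using inner_orthonormal_sum[OF assms(1,2) that, of a] a by simp
  then show ?thesis using a by simp
qed

lemma parseval:
  assumes "orthonormal U" "finite U" "span U = UNIV"
  shows "(norm x)\<^sup>2 = (\<Sum>u\<in>U. (x \<bullet> u)\<^sup>2)"
  using norm_orthonormal_sum[OF assms(1,2), of "\<lambda>u. x \<bullet> u"]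
    orthonormal_expand[OF assms(1,2), of x] assms(3) by simp

lemma bessel:
  assumes "orthonormal U" "finite U"
  shows "(\<Sum>u\<in>U. (x \<bullet> u)\<^sup>2) \<le> (norm x)\<^sup>2"
proof -
  define p where "p = (\<Sum>u\<in>U. (x \<bullet> u) *\<^sub>R u)"
  have 1: "(norm p)\<^sup>2 = (\<Sum>u\<in>U. (x \<bullet> u)\<^sup>2)"
    unfolding p_def by (rule norm_orthonormal_sum[OF assms])
  have 2: "x \<bullet> p = (\<Sum>u\<in>U. (x \<bullet> u)\<^sup>2)"
    unfolding p_def by (simp add: inner_sum_right power2_eq_square)
  have "0 \<le> (norm (x - p))\<^sup>2" by simp
  also have "\<dots> = (norm x)\<^sup>2 - 2 * (x \<bullet> p) + (norm p)\<^sup>2"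
    by (simp add: power2_norm_eq_inner inner_diff_left inner_diff_right inner_commute)
  finally show ?thesis using 1 2 by simp
qed

section \<open>The spectral theorem for self-adjoint operators\<close>

text \<open>
  A maximiser \<open>x\<close> of the Rayleigh quotient on the invariant subspace is an eigenvector: with \<open>c\<close> the
  maximum, \<open>g = c - f\<close> is a positive semidefinite form on \<open>S\<close> that vanishes at \<open>x\<close>, and such a
  form has \<open>x\<close> in its kernel.
\<close>
lemma self_adjoint_eigenvector:
  fixes f :: "'a::euclidean_space \<Rightarrow> 'a"
  assumes lin: "linear f" and adj: "\<And>x y. f x \<bullet> y = x \<bullet> f y"
    and S: "subspace S" "\<And>x. x \<in> S \<Longrightarrow> f x \<in> S" and z: "z \<in> S" "z \<noteq> 0"
  obtains x c where "x \<in> S" "norm x = 1" "f x = c *\<^sub>R x"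
proof -
  let ?K = "S \<inter> sphere 0 1"
  have "compact ?K"
    using closed_Int_compact[OF closed_subspace[OF S(1)] compact_sphere] by blast
  moreover have "z /\<^sub>R norm z \<in> ?K"
    using z S(1) by (simp add: subspace_scale)
  then have "?K \<noteq> {}" by blast
  moreover have "continuous_on ?K (\<lambda>x. x \<bullet> f x)"
    by (intro continuous_intros linear_continuous_on linear_conv_bounded_linear[THEN iffD1] lin)
  ultimately obtain x where x: "x \<in> ?K" and mx: "\<And>y. y \<in> ?K \<Longrightarrow> y \<bullet> f y \<le> x \<bullet> f x"
    by (metis continuous_attains_sup)
  define c where "c = x \<bullet> f x"
  define g where "g y = c *\<^sub>R y - f y" for y
  have xS: "x \<in> S" and nx: "norm x = 1" using x by auto
  have xx: "x \<bullet> x = 1" using nx by (simp add: norm_eq_1)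
  have g_nonneg: "0 \<le> y \<bullet> g y" if "y \<in> S" for y
  proof (cases "y = 0")
    case False
    have "y /\<^sub>R norm y \<in> ?K" using False that S(1) by (simp add: subspace_scale)
    from mx[OF this] have "(y \<bullet> f y) / (norm y)\<^sup>2 \<le> c"
      by (simp add: c_def linear_scale[OF lin] power2_eq_square divide_simps mult_ac)
    then have "y \<bullet> f y \<le> c * (norm y)\<^sup>2" using False by (simp add: divide_simps)
    then show ?thesis by (simp add: g_def inner_diff_right power2_norm_eq_inner)
  qed (simp add: g_def)
  have gx: "x \<bullet> g x = 0" by (simp add: g_def inner_diff_right xx c_def)
  define w where "w = g x"
  define b where "b = w \<bullet> w"
  define d where "d = \<bar>w \<bullet> g w\<bar> + 1"
  have wS: "w \<in> S" unfolding w_def g_def using xS S by (simp add: subspace_diff subspace_scale)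
  \<comment> \<open>At \<open>x + t w\<close> the form is at most \<open>2 t b + t\<^sup>2 d\<close>, which is smallest at this \<open>t\<close>.\<close>
  define t where "t = - b / d"
  have d0: "d > 0" by (simp add: d_def)
  have gadd: "g (x + t *\<^sub>R w) = g x + t *\<^sub>R g w"
    by (simp add: g_def linear_add[OF lin] linear_scale[OF lin] algebra_simps)
  have gadj: "x \<bullet> g w = w \<bullet> g x"
    unfolding g_def inner_diff_right using adj[of x w] by (simp add: inner_commute)
  have "0 \<le> (x + t *\<^sub>R w) \<bullet> g (x + t *\<^sub>R w)"
    using xS wS S(1) by (intro g_nonneg) (simp add: subspace_add subspace_scale)
  also have "\<dots> = 2 * t * b + t\<^sup>2 * (w \<bullet> g w)"
    unfolding gadd using gx gadj
    by (simp add: inner_add_left inner_add_right b_def w_def[symmetric] power2_eq_square algebra_simps)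
  also have "\<dots> \<le> 2 * t * b + t\<^sup>2 * d"
    by (intro add_left_mono mult_left_mono) (auto simp: d_def)
  also have "\<dots> = - b\<^sup>2 / d"
    using d0 by (simp add: t_def power2_eq_square field_simps)
  finally have "b\<^sup>2 \<le> 0" using d0 by (simp add: divide_simps)
  then have "w = 0" by (simp add: b_def)
  then have "f x = c *\<^sub>R x" by (simp add: w_def g_def)
  with that xS nx show ?thesis by blast
qed

text \<open>
  An orthonormal set of eigenvectors of maximal size spans: its orthogonal complement is invariant,
  so it would otherwise contain a further unit eigenvector.
\<close>
theorem spectral_theorem:
  fixes f :: "'a::euclidean_space \<Rightarrow> 'a"
  assumes lin: "linear f" and adj: "\<And>x y. f x \<bullet> y = x \<bullet> f y"
  obtains U e where "finite U" "orthonormal U" "span U = UNIV" "\<And>u. u \<in> U \<Longrightarrow> f u = e u *\<^sub>R u"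
proof -
  define P where "P U \<longleftrightarrow> orthonormal U \<and> (\<forall>u\<in>U. \<exists>c. f u = c *\<^sub>R u)" for U :: "'a set"
  have "P {}" by (simp add: P_def orthonormal_def)
  moreover have "\<forall>U. P U \<longrightarrow> card U < Suc (DIM('a))"
    using orthonormal_finite_card(2) by (auto simp: P_def less_Suc_eq_le)
  ultimately obtain U where U: "P U" and mx: "\<And>V. P V \<Longrightarrow> card V \<le> card U"
    using ex_has_greatest_nat[of P "{}" card "Suc (DIM('a))"] by blast
  have on: "orthonormal U" and fin: "finite U"
    using U orthonormal_finite_card(1) by (auto simp: P_def)
  obtain e where e: "\<And>u. u \<in> U \<Longrightarrow> f u = e u *\<^sub>R u"
    using U unfolding P_def by metis
  have "x \<in> span U" for x
  proof (rule ccontr)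
    assume nx: "x \<notin> span U"
    define S where "S = {y. \<forall>u\<in>U. y \<bullet> u = 0}"
    define z where "z = x - (\<Sum>u\<in>U. (x \<bullet> u) *\<^sub>R u)"
    have S: "subspace S"
      by (auto simp: S_def subspace_def inner_add_left)
    have fS: "f y \<in> S" if "y \<in> S" for y
      using that by (auto simp: S_def adj e)
    have zS: "z \<in> S"
      unfolding S_def z_def by (simp add: inner_diff_left inner_orthonormal_sum[OF on fin])
    have "(\<Sum>u\<in>U. (x \<bullet> u) *\<^sub>R u) \<in> span U"
      by (intro span_sum span_scale span_base)
    then have "z \<noteq> 0" using nx by (auto simp: z_def)
    then obtain y c where y: "y \<in> S" "norm y = 1" "f y = c *\<^sub>R y"
      using self_adjoint_eigenvector[OF lin adj S fS zS] by metis
    have yU: "y \<notin> U" using y by (auto simp: S_def norm_eq_1)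
    have "P (insert y U)"
      using y U unfolding P_def orthonormal_def S_def
      by (auto simp: norm_eq_1 inner_commute)
    from mx[OF this] show False using yU fin by simp
  qed
  with that fin on e show ?thesis by blast
qed

section \<open>Squared eigenvalue gaps over a set of pairs\<close>

text \<open>
  The operator \<open>\<Sum>p. w p w p\<^sup>T\<close> has the same largest eigenvalue as the Gram matrix of the \<open>w p\<close>,
  whose absolute row sums are at most \<open>2 + (card P - 1)\<close>.
\<close>
lemma gram_schur_bound:
  fixes w :: "'i \<Rightarrow> 'a::real_inner"
  assumes fin: "finite P"
    and diag: "\<And>p. p \<in> P \<Longrightarrow> w p \<bullet> w p \<le> 2"
    and off: "\<And>p q. p \<in> P \<Longrightarrow> q \<in> P \<Longrightarrow> p \<noteq> q \<Longrightarrow> \<bar>w p \<bullet> w q\<bar> \<le> 1"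
  shows "(\<Sum>p\<in>P. (x \<bullet> w p)\<^sup>2) \<le> (real (card P) + 1) * (norm x)\<^sup>2"
proof -
  define y where "y p = x \<bullet> w p" for p
  define z where "z = (\<Sum>p\<in>P. y p *\<^sub>R w p)"
  define Y where "Y = (\<Sum>p\<in>P. (y p)\<^sup>2)"
  have Y0: "0 \<le> Y" by (simp add: Y_def sum_nonneg)
  have xz: "x \<bullet> z = Y"
    by (simp add: z_def Y_def inner_sum_right y_def power2_eq_square)
  have pt: "y p * y q * (w p \<bullet> w q) \<le> ((y p)\<^sup>2 + (y q)\<^sup>2) / 2 + (if p = q then (y p)\<^sup>2 else 0)"
    if "p \<in> P" "q \<in> P" for p q
  proof (cases "p = q")
    case True
    have "(y p)\<^sup>2 * (w p \<bullet> w p) \<le> (y p)\<^sup>2 * 2"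
      by (intro mult_left_mono diag that) simp
    then show ?thesis using True by (simp add: power2_eq_square)
  next
    case False
    have "y p * y q * (w p \<bullet> w q) \<le> \<bar>y p * y q\<bar> * \<bar>w p \<bullet> w q\<bar>"
      by (metis abs_ge_self abs_mult)
    also have "\<dots> \<le> \<bar>y p * y q\<bar> * 1"
      by (intro mult_left_mono off that False) simp
    also have "\<dots> \<le> ((y p)\<^sup>2 + (y q)\<^sup>2) / 2"
      using sum_squares_bound[of "\<bar>y p\<bar>" "\<bar>y q\<bar>"] by (simp add: abs_mult)
    finally show ?thesis using False by simp
  qed
  have "(norm z)\<^sup>2 = (\<Sum>p\<in>P. \<Sum>q\<in>P. y p * y q * (w p \<bullet> w q))"
    unfolding power2_norm_eq_inner z_def
    by (simp add: inner_sum_left inner_sum_right sum_distrib_left mult_ac inner_commute)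
  also have "\<dots> \<le> (\<Sum>p\<in>P. \<Sum>q\<in>P. ((y p)\<^sup>2 + (y q)\<^sup>2) / 2 + (if p = q then (y p)\<^sup>2 else 0))"
    by (intro sum_mono pt)
  also have "\<dots> = (real (card P) + 1) * Y"
    using fin by (simp add: Y_def sum.distrib add_divide_distrib sum_divide_distrib[symmetric]
        sum_distrib_left[symmetric] algebra_simps)
  finally have nz: "(norm z)\<^sup>2 \<le> (real (card P) + 1) * Y" .
  have "Y\<^sup>2 \<le> (norm x)\<^sup>2 * (norm z)\<^sup>2"
    using Cauchy_Schwarz_ineq[of x z] by (simp add: xz power2_norm_eq_inner)
  also have "\<dots> \<le> (norm x)\<^sup>2 * ((real (card P) + 1) * Y)"
    by (intro mult_left_mono nz) simp
  finally have "Y * Y \<le> ((real (card P) + 1) * (norm x)\<^sup>2) * Y"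
    by (simp add: power2_eq_square mult_ac)
  then have "Y \<le> (real (card P) + 1) * (norm x)\<^sup>2"
    using Y0 by (cases "Y = 0") (auto simp: mult_le_cancel_right)
  then show ?thesis by (simp add: Y_def y_def)
qed

text \<open>
  The vectors \<open>u - v\<close> for \<open>(u, v)\<close> in \<open>P\<close> are the columns of the incidence matrix of a graph. The
  hypothesis that \<open>e\<close> decreases along every pair rules out loops and the presence of both
  orientations of one edge, so distinct edges share at most one vertex and have inner product at
  most 1 in absolute value.
\<close>
lemma sum_sq_gaps_le:
  fixes e :: "'a::real_inner \<Rightarrow> real"
  assumes on: "orthonormal U" and fin: "finite U" and PU: "P \<subseteq> U \<times> U"
    and gap: "\<And>u v. (u, v) \<in> P \<Longrightarrow> e v < e u"
  shows "(\<Sum>(u, v)\<in>P. (e u - e v)\<^sup>2) \<le> (real (card P) + 1) * (\<Sum>u\<in>U. (e u)\<^sup>2)"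
proof -
  define x where "x = (\<Sum>u\<in>U. e u *\<^sub>R u)"
  define w where "w p = fst p - snd p" for p :: "'a \<times> 'a"
  have finP: "finite P" using PU fin finite_subset by blast
  have ip: "u \<bullet> v = (if u = v then 1 else 0)" if "u \<in> U" "v \<in> U" for u v
    using on that by (auto simp: orthonormal_def)
  have "(\<Sum>p\<in>P. (x \<bullet> w p)\<^sup>2) \<le> (real (card P) + 1) * (norm x)\<^sup>2"
  proof (rule gram_schur_bound[OF finP])
    fix p assume p: "p \<in> P"
    obtain u v where [simp]: "p = (u, v)" by (cases p)
    show "w p \<bullet> w p \<le> 2"
      using p PU by (auto simp: w_def inner_diff_left inner_diff_right ip)
  next
    fix p q assume p: "p \<in> P" and q: "q \<in> P" and pq: "p \<noteq> q"
    obtain u v where [simp]: "p = (u, v)" by (cases p)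
    obtain u' v' where [simp]: "q = (u', v')" by (cases q)
    have mem: "u \<in> U" "v \<in> U" "u' \<in> U" "v' \<in> U" using p q PU by auto
    show "\<bar>w p \<bullet> w q\<bar> \<le> 1"
      using p q pq mem gap[of u v] gap[of u' v']
      by (auto simp: w_def inner_diff_left inner_diff_right ip)
  qed
  moreover have "(norm x)\<^sup>2 = (\<Sum>u\<in>U. (e u)\<^sup>2)"
    unfolding x_def by (rule norm_orthonormal_sum[OF on fin])
  moreover have "(\<Sum>p\<in>P. (x \<bullet> w p)\<^sup>2) = (\<Sum>(u, v)\<in>P. (e u - e v)\<^sup>2)"
    by (rule sum.cong)
       (use PU in \<open>auto simp: w_def inner_diff_right x_def inner_orthonormal_sum[OF on fin]\<close>)
  ultimately show ?thesis by simp
qed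

section \<open>Commutators and matrix entries in an orthonormal basis\<close>

lemma matrix_add_distrib_right: "(B + C) ** A = B ** A + C ** A"
  for A B C :: "real ^ 'n ^ 'n"
  by (simp add: matrix_matrix_mult_def vec_eq_iff sum.distrib distrib_right)

lemma linear_commutator_left: "linear (\<lambda>X. commutator X B)"
  for B :: "real ^ 'n ^ 'n"
  by (rule linearI) (simp_all add: commutator_def matrix_add_ldistrib matrix_add_distrib_right
      scalar_matrix_assoc matrix_scalar_ac algebra_simps)

lemma commutator_swap: "commutator A B = - commutator B A"
  by (simp add: commutator_def)

lemma norm_commutator_swap: "norm (commutator A B) = norm (commutator B A)"
  by (metis commutator_swap norm_minus_cancel)

lemma commutator_self: "commutator A A = 0"
  by (simp add: commutator_def)

lemma symmetric_matrix_self_adjoint: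
  fixes A :: "real ^ 'n ^ 'n"
  assumes "transpose A = A"
  shows "(A *v x) \<bullet> y = x \<bullet> (A *v y)"
  by (metis assms dot_lmul_matrix vector_transpose_matrix)

definition outer :: "real ^ 'n \<Rightarrow> real ^ 'n \<Rightarrow> real ^ 'n ^ 'n" where
  "outer v u = (\<chi> i j. v $ i * u $ j)"

lemma inner_outer: "M \<bullet> outer v u = v \<bullet> (M *v u)"
  by (simp add: outer_def inner_vec_def matrix_vector_mult_def sum_distrib_left mult_ac)

lemma outer_mult_vec: "outer v u *v x = (u \<bullet> x) *\<^sub>R v"
  by (simp add: outer_def matrix_vector_mult_def vec_eq_iff inner_vec_def sum_distrib_left mult_ac)

lemma norm_sq_matrix:
  fixes M :: "real ^ 'n ^ 'n"
  assumes "orthonormal U" "finite U" "span U = UNIV"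
  shows "(norm M)\<^sup>2 = (\<Sum>u\<in>U. (norm (M *v u))\<^sup>2)"
    and "(norm M)\<^sup>2 = (\<Sum>u\<in>U. \<Sum>v\<in>U. (v \<bullet> (M *v u))\<^sup>2)"
proof -
  have sq: "(norm (x :: ('b::real_inner) ^ 'n))\<^sup>2 = (\<Sum>i\<in>UNIV. (norm (x $ i))\<^sup>2)" for x
    by (simp add: power2_norm_eq_inner inner_vec_def)
  have "(norm M)\<^sup>2 = (\<Sum>i\<in>UNIV. \<Sum>u\<in>U. (M $ i \<bullet> u)\<^sup>2)"
    by (subst sq) (simp only: parseval[OF assms])
  also have "\<dots> = (\<Sum>u\<in>U. \<Sum>i\<in>UNIV. (M $ i \<bullet> u)\<^sup>2)"
    by (rule sum.swap)
  also have "\<dots> = (\<Sum>u\<in>U. (norm (M *v u))\<^sup>2)"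
    by (simp add: sq[of "M *v u" for u] matrix_vector_mul_component)
  finally show 1: "(norm M)\<^sup>2 = (\<Sum>u\<in>U. (norm (M *v u))\<^sup>2)" .
  then show "(norm M)\<^sup>2 = (\<Sum>u\<in>U. \<Sum>v\<in>U. (v \<bullet> (M *v u))\<^sup>2)"
    by (simp add: parseval[OF assms] inner_commute)
qed

text \<open>
  Bessel's inequality for the matrix \<open>v u\<^sup>T + u v\<^sup>T\<close>, which has squared norm 2. On
  symmetric matrices its inner product is twice the \<open>(v, u)\<close> entry; this doubling gains the
  factor \<open>1/2\<close> over the bound for \<open>v u\<^sup>T\<close> alone.
\<close>
lemma sum_sq_entry_le_half:
  fixes S :: "(real ^ 'n ^ 'n) set"
  assumes on: "orthonormal S" "finite S" and sym: "\<And>B. B \<in> S \<Longrightarrow> transpose B = B"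
    and uv: "norm u = 1" "norm v = 1" "u \<bullet> v = 0"
  shows "(\<Sum>B\<in>S. (v \<bullet> (B *v u))\<^sup>2) \<le> 1 / 2"
proof -
  define E where "E = outer v u + outer u v"
  have E: "B \<bullet> E = 2 * (v \<bullet> (B *v u))" if "B \<in> S" for B
    using symmetric_matrix_self_adjoint[OF sym[OF that], of v u]
    by (simp add: E_def inner_add_right inner_outer inner_commute)
  have "(norm E)\<^sup>2 = 2"
    using uv unfolding power2_norm_eq_inner
    by (simp add: E_def inner_add_right inner_add_left inner_outer outer_mult_vec inner_commute norm_eq_1)
  then have "(\<Sum>B\<in>S. (E \<bullet> B)\<^sup>2) \<le> 2"
    using bessel[OF on, of E] by simp
  also have "(\<Sum>B\<in>S. (E \<bullet> B)\<^sup>2) = 4 * (\<Sum>B\<in>S. (v \<bullet> (B *v u))\<^sup>2)"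
    unfolding sum_distrib_left by (rule sum.cong) (simp_all add: E inner_commute[of E] power_mult_distrib)
  finally show ?thesis by simp
qed

section \<open>Commutators with an orthonormal set of symmetric matrices\<close>

text \<open>
  In an eigenbasis of \<open>A\<close> the \<open>(v, u)\<close> entry of the commutator is \<open>(e v - e u)\<close> times that of \<open>B\<close>.
  The pairs with \<open>\<bar>e v - e u\<bar> \<le> 1\<close> contribute at most their weight. For the others the excess
  factor \<open>(e v - e u)\<^sup>2 - 1\<close> meets a weight of at most \<open>1/2\<close>, and each such pair occurs in
  two orders, so the total excess is that of \<open>P\<close>, the pairs taken in the order of decreasing \<open>e\<close>.
\<close>
lemma sum_norm_sq_commutator_le:
  fixes A :: "real ^ 'n ^ 'n"
  assumes symA: "transpose A = A" and nA: "norm A = 1"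
    and S: "orthonormal S" "finite S" and sym: "\<And>B. B \<in> S \<Longrightarrow> transpose B = B"
  shows "(\<Sum>B\<in>S. (norm (commutator A B))\<^sup>2) \<le> real (card S) + 1"
proof -
  obtain U e where U: "orthonormal U" "finite U" "span U = UNIV"
    and e: "\<And>u. u \<in> U \<Longrightarrow> A *v u = e u *\<^sub>R u"
    using spectral_theorem[OF matrix_vector_mul_linear symmetric_matrix_self_adjoint[OF symA]] by metis
  define r where "r u v = (\<Sum>B\<in>S. (v \<bullet> (B *v u))\<^sup>2)" for u v
  define h where "h u v = (if e u - e v > 1 then ((e u - e v)\<^sup>2 - 1) / 2 else 0)" for u v
  define P where "P = {(u, v) \<in> U \<times> U. e u - e v > 1}"
  have P_sub: "P \<subseteq> U \<times> U" and P_gap: "\<And>u v. (u, v) \<in> P \<Longrightarrow> e v < e u"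
    by (auto simp: P_def)
  have sum_e: "(\<Sum>u\<in>U. (e u)\<^sup>2) = 1"
    using norm_sq_matrix(1)[OF U, of A] by (simp add: e nA orthonormal_norm[OF U(1)] cong: sum.cong)
  have comm: "v \<bullet> (commutator A B *v u) = (e v - e u) * (v \<bullet> (B *v u))" if "u \<in> U" "v \<in> U" for u v B
  proof -
    have "v \<bullet> (commutator A B *v u) = v \<bullet> (A *v (B *v u)) - v \<bullet> (B *v (A *v u))"
      by (simp add: commutator_def matrix_vector_mult_diff_rdistrib matrix_vector_mul_assoc inner_diff_right)
    also have "v \<bullet> (A *v (B *v u)) = e v * (v \<bullet> (B *v u))"
      using symmetric_matrix_self_adjoint[OF symA, of v "B *v u"] e[OF that(2)] by simp
    also have "v \<bullet> (B *v (A *v u)) = e u * (v \<bullet> (B *v u))"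
      by (simp add: e[OF that(1)] matrix_vector_mult_scaleR)
    finally show ?thesis by (simp add: algebra_simps)
  qed
  have "(\<Sum>B\<in>S. (norm (commutator A B))\<^sup>2)
      = (\<Sum>B\<in>S. \<Sum>u\<in>U. \<Sum>v\<in>U. (e v - e u)\<^sup>2 * (v \<bullet> (B *v u))\<^sup>2)"
    unfolding norm_sq_matrix(2)[OF U] by (intro sum.cong refl) (simp add: comm power_mult_distrib)
  also have "\<dots> = (\<Sum>u\<in>U. \<Sum>v\<in>U. (e v - e u)\<^sup>2 * r u v)"
    by (subst sum.swap, rule sum.cong[OF refl], subst sum.swap) (simp add: r_def sum_distrib_left)
  finally have total: "(\<Sum>B\<in>S. (norm (commutator A B))\<^sup>2) = (\<Sum>u\<in>U. \<Sum>v\<in>U. (e v - e u)\<^sup>2 * r u v)" .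
  have "real (card S) = (\<Sum>B\<in>S. (norm B)\<^sup>2)"
    by (simp add: orthonormal_norm[OF S(1)])
  also have "\<dots> = (\<Sum>u\<in>U. \<Sum>v\<in>U. r u v)"
    unfolding norm_sq_matrix(2)[OF U] r_def
    by (subst sum.swap, rule sum.cong[OF refl], subst sum.swap) simp
  finally have card: "real (card S) = (\<Sum>u\<in>U. \<Sum>v\<in>U. r u v)" .
  have r0: "0 \<le> r u v" for u v by (simp add: r_def sum_nonneg)
  have r_half: "r u v \<le> 1 / 2" if "u \<in> U" "v \<in> U" "u \<noteq> v" for u v
    unfolding r_def using sum_sq_entry_le_half[OF S sym, of u v] U(1) that
    by (simp add: orthonormal_norm) (simp add: orthonormal_def)
  have pt: "(e v - e u)\<^sup>2 * r u v \<le> r u v + (h u v + h v u)" if uv: "u \<in> U" "v \<in> U" for u v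
  proof (cases "\<bar>e v - e u\<bar> > 1")
    case True
    then have "u \<noteq> v" by auto
    have "1 \<le> (e v - e u)\<^sup>2" using True abs_square_le_1[of "e v - e u"] by linarith
    then have "((e v - e u)\<^sup>2 - 1) * r u v \<le> ((e v - e u)\<^sup>2 - 1) * (1 / 2)"
      by (intro mult_left_mono r_half uv \<open>u \<noteq> v\<close>) simp
    also have "\<dots> = h u v + h v u"
      using True by (auto simp: h_def power2_commute[of "e v"])
    finally show ?thesis by (simp add: algebra_simps)
  next
    case False
    then have "(e v - e u)\<^sup>2 \<le> 1" by (simp add: abs_square_le_1)
    then have "(e v - e u)\<^sup>2 * r u v \<le> 1 * r u v" by (intro mult_right_mono r0)
    moreover have "h u v = 0" "h v u = 0" using False by (auto simp: h_def)
    ultimately show ?thesis by simp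
  qed
  have "(\<Sum>u\<in>U. \<Sum>v\<in>U. h u v) = (\<Sum>(u, v)\<in>U \<times> U. h u v)"
    by (simp add: sum.cartesian_product)
  also have "\<dots> = (\<Sum>(u, v)\<in>P. ((e u - e v)\<^sup>2 - 1) / 2)"
    by (rule sum.mono_neutral_cong_right) (use U in \<open>auto simp: P_def h_def split: if_splits\<close>)
  also have "\<dots> = ((\<Sum>(u, v)\<in>P. (e u - e v)\<^sup>2) - real (card P)) / 2"
    by (simp add: case_prod_beta sum_subtractf sum_divide_distrib[symmetric])
  also have "\<dots> \<le> 1 / 2"
    using sum_sq_gaps_le[OF U(1,2), of P e] sum_e by (simp add: P_sub P_gap)
  finally have h: "(\<Sum>u\<in>U. \<Sum>v\<in>U. h u v) \<le> 1 / 2" .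
  have "(\<Sum>u\<in>U. \<Sum>v\<in>U. (e v - e u)\<^sup>2 * r u v) \<le> (\<Sum>u\<in>U. \<Sum>v\<in>U. r u v + (h u v + h v u))"
    by (intro sum_mono pt)
  also have "\<dots> = (\<Sum>u\<in>U. \<Sum>v\<in>U. r u v) + (\<Sum>u\<in>U. \<Sum>v\<in>U. h u v) + (\<Sum>u\<in>U. \<Sum>v\<in>U. h v u)"
    by (simp add: sum.distrib)
  also have "(\<Sum>u\<in>U. \<Sum>v\<in>U. h v u) = (\<Sum>u\<in>U. \<Sum>v\<in>U. h u v)"
    by (rule sum.swap)
  finally show ?thesis using total card h by linarith
qed

section \<open>Principal axes of a family of vectors\<close>

text \<open>
  The eigenvectors with nonzero eigenvalue of \<open>x \<mapsto> (\<Sum>r. (A r \<bullet> x) A r)\<close>. They lie in the range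
  of this operator, hence in the span of the family; the eigenvectors with eigenvalue 0 are
  orthogonal to every \<open>A r\<close>, so discarding them keeps the family in the span of the rest.
\<close>
lemma principal_axes:
  fixes A :: "'i \<Rightarrow> 'a::euclidean_space"
  assumes fin: "finite R"
  obtains K t where "finite K" "orthonormal K" "K \<subseteq> span (A ` R)"
    "\<forall>r\<in>R. A r \<in> span K" "\<forall>k. 0 \<le> t k"
    "\<forall>k\<in>K. \<forall>l\<in>K. (\<Sum>r\<in>R. (A r \<bullet> k) * (A r \<bullet> l)) = (if k = l then t k else 0)"
proof -
  define f where "f x = (\<Sum>r\<in>R. (A r \<bullet> x) *\<^sub>R A r)" for x
  have lin: "linear f"
    by (rule linearI) (simp_all add: f_def inner_add_right scaleR_add_left sum.distrib scaleR_sum_right)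
  have f_inner: "f x \<bullet> y = (\<Sum>r\<in>R. (A r \<bullet> x) * (A r \<bullet> y))" for x y
    by (simp add: f_def inner_sum_left)
  have adj: "f x \<bullet> y = x \<bullet> f y" for x y
    by (subst (2) inner_commute) (simp add: f_inner mult.commute)
  obtain U e where U: "finite U" "orthonormal U" "span U = UNIV"
    and e: "\<And>u. u \<in> U \<Longrightarrow> f u = e u *\<^sub>R u"
    using spectral_theorem[OF lin adj] by metis
  define t where "t k = (\<Sum>r\<in>R. (A r \<bullet> k)\<^sup>2)" for k
  define K where "K = {u \<in> U. t u \<noteq> 0}"
  have gram: "(\<Sum>r\<in>R. (A r \<bullet> k) * (A r \<bullet> l)) = (if k = l then t k else 0)" if "k \<in> U" "l \<in> U" for k l
  proof (cases "k = l")
    case False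
    then have "f k \<bullet> l = 0" using e[OF that(1)] U(2) that by (simp add: orthonormal_def)
    then show ?thesis using False by (simp add: f_inner)
  qed (simp add: t_def power2_eq_square)
  have "k \<in> span (A ` R)" if "k \<in> K" for k
  proof -
    have k: "k \<in> U" "t k \<noteq> 0" using that by (auto simp: K_def)
    have "e k = f k \<bullet> k" using e[OF k(1)] U(2) k by (simp add: orthonormal_def)
    also have "\<dots> = t k" using gram[OF k(1) k(1)] by (simp add: f_inner)
    finally have "k = f k /\<^sub>R t k" using e[OF k(1)] k(2) by simp
    moreover have "f k /\<^sub>R t k \<in> span (A ` R)"
      unfolding f_def by (intro span_scale span_sum span_base) auto
    ultimately show ?thesis by simp
  qed
  then have K_sub: "K \<subseteq> span (A ` R)" by blast
  have spanK: "A r \<in> span K" if R: "r \<in> R" for r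
  proof -
    have "(A r \<bullet> u) *\<^sub>R u \<in> span K" if "u \<in> U" for u
    proof (cases "t u = 0")
      case True
      then have "A r \<bullet> u = 0" using R fin by (simp add: t_def sum_nonneg_eq_0_iff)
      then show ?thesis by (simp add: span_zero)
    next
      case False
      then show ?thesis using that by (intro span_scale span_base) (simp add: K_def)
    qed
    then have "(\<Sum>u\<in>U. (A r \<bullet> u) *\<^sub>R u) \<in> span K" by (rule span_sum)
    then show ?thesis using orthonormal_expand[OF U(2,1), of "A r"] U(3) by simp
  qed
  have KU: "K \<subseteq> U" by (auto simp: K_def)
  have "finite K" "orthonormal K"
    using U KU orthonormal_subset finite_subset by blast+
  moreover have "\<forall>k. 0 \<le> t k" by (simp add: t_def sum_nonneg)
  moreover have "\<forall>k\<in>K. \<forall>l\<in>K. (\<Sum>r\<in>R. (A r \<bullet> k) * (A r \<bullet> l)) = (if k = l then t k else 0)"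
    using gram KU by blast
  ultimately show ?thesis
    using that[of K t] K_sub spanK by blast
qed

text \<open>
  Expanding \<open>A r\<close> in \<open>K\<close>, the mixed terms cancel in the sum over \<open>r\<close>. With \<open>f\<close> a commutator this
  replaces one of its arguments by the principal axes, and with \<open>f\<close> the identity it is the trace
  formula \<open>\<Sum>r. (norm (A r))\<^sup>2 = \<Sum>k. t k\<close>.
\<close>
lemma sum_norm_sq_linear_image:
  fixes f :: "'a::euclidean_space \<Rightarrow> 'b::real_inner"
  assumes K: "orthonormal K" "finite K" and span: "\<And>r. r \<in> R \<Longrightarrow> A r \<in> span K"
    and gram: "\<And>k l. k \<in> K \<Longrightarrow> l \<in> K \<Longrightarrow> (\<Sum>r\<in>R. (A r \<bullet> k) * (A r \<bullet> l)) = (if k = l then t k else 0)"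
    and lin: "linear f"
  shows "(\<Sum>r\<in>R. (norm (f (A r)))\<^sup>2) = (\<Sum>k\<in>K. t k * (norm (f k))\<^sup>2)"
proof -
  have f: "f (A r) = (\<Sum>k\<in>K. (A r \<bullet> k) *\<^sub>R f k)" if "r \<in> R" for r
    by (subst orthonormal_expand[OF K span[OF that]])
       (simp add: linear_sum[OF lin] linear_scale[OF lin])
  have "(\<Sum>r\<in>R. (norm (f (A r)))\<^sup>2)
      = (\<Sum>r\<in>R. \<Sum>k\<in>K. \<Sum>l\<in>K. ((A r \<bullet> k) * (A r \<bullet> l)) * (f k \<bullet> f l))"
    unfolding power2_norm_eq_inner
    by (rule sum.cong[OF refl])
       (simp add: f inner_sum_left inner_sum_right sum_distrib_left mult_ac inner_commute)
  also have "\<dots> = (\<Sum>k\<in>K. \<Sum>l\<in>K. (\<Sum>r\<in>R. (A r \<bullet> k) * (A r \<bullet> l)) * (f k \<bullet> f l))"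
    by (subst sum.swap, rule sum.cong[OF refl], subst sum.swap) (simp add: sum_distrib_right)
  also have "\<dots> = (\<Sum>k\<in>K. \<Sum>l\<in>K. if k = l then t k * (f k \<bullet> f l) else 0)"
    by (intro sum.cong refl) (simp add: gram)
  also have "\<dots> = (\<Sum>k\<in>K. t k * (norm (f k))\<^sup>2)"
    using K by (simp add: power2_norm_eq_inner)
  finally show ?thesis .
qed

section \<open>The inequality\<close>

text \<open>
  With \<open>d\<close> the positive part of \<open>c - 1\<close>, the hypothesis on the subset \<open>{l. c k l > 1}\<close> bounds the row
  sums of \<open>d\<close> by 1, and the diagonal terms \<open>(t k)\<^sup>2\<close> of the square absorb the resulting
  \<open>\<Sum>k l. t k t l d k l\<close>.
\<close>
lemma weighted_sum_le_square:
  fixes c :: "'k \<Rightarrow> 'k \<Rightarrow> real"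
  assumes fin: "finite K" and t0: "\<And>k. 0 \<le> t k" and diag: "\<And>k. c k k = 0"
    and sym: "\<And>k l. c k l = c l k"
    and row: "\<And>k S. k \<in> K \<Longrightarrow> S \<subseteq> K \<Longrightarrow> (\<Sum>l\<in>S. c k l) \<le> real (card S) + 1"
  shows "(\<Sum>k\<in>K. \<Sum>l\<in>K. t k * t l * c k l) \<le> (\<Sum>k\<in>K. t k)\<^sup>2"
proof -
  define d where "d k l = max 0 (c k l - 1)" for k l
  have d0: "0 \<le> d k l" for k l by (simp add: d_def)
  have drow: "(\<Sum>l\<in>K. d k l) \<le> 1" if "k \<in> K" for k
  proof -
    define S where "S = {l \<in> K. c k l > 1}"
    have "(\<Sum>l\<in>K. d k l) = (\<Sum>l\<in>S. c k l - 1)"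
      by (rule sum.mono_neutral_cong_right) (use fin in \<open>auto simp: S_def d_def\<close>)
    also have "\<dots> \<le> 1" using row[OF that, of S] by (auto simp: S_def sum_subtractf)
    finally show ?thesis .
  qed
  have pt: "t k * t l * c k l \<le> t k * t l + ((t k)\<^sup>2 * d k l + (t l)\<^sup>2 * d l k) / 2
      - (if k = l then (t k)\<^sup>2 else 0)" for k l
  proof (cases "k = l")
    case True
    then show ?thesis using d0[of k k] t0[of k] by (simp add: diag power2_eq_square)
  next
    case False
    have "t k * t l * c k l \<le> t k * t l * (1 + d k l)"
      by (intro mult_left_mono) (simp_all add: d_def t0)
    moreover have "t k * t l * d k l \<le> ((t k)\<^sup>2 + (t l)\<^sup>2) / 2 * d k l"
      using sum_squares_bound[of "t k" "t l"] by (intro mult_right_mono d0) simp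
    moreover have "d l k = d k l" by (simp add: d_def sym)
    ultimately show ?thesis using False by (simp add: algebra_simps add_divide_distrib)
  qed
  have sq: "(\<Sum>k\<in>K. \<Sum>l\<in>K. (t k)\<^sup>2 * d k l) \<le> (\<Sum>k\<in>K. (t k)\<^sup>2)"
    unfolding sum_distrib_left[symmetric]
    by (intro sum_mono) (use mult_left_mono[OF drow] in fastforce)
  have "(\<Sum>k\<in>K. \<Sum>l\<in>K. t k * t l * c k l)
     \<le> (\<Sum>k\<in>K. \<Sum>l\<in>K. t k * t l + ((t k)\<^sup>2 * d k l + (t l)\<^sup>2 * d l k) / 2
      - (if k = l then (t k)\<^sup>2 else 0))"
    by (intro sum_mono pt)
  also have "\<dots> = (\<Sum>k\<in>K. \<Sum>l\<in>K. t k * t l) + ((\<Sum>k\<in>K. \<Sum>l\<in>K. (t k)\<^sup>2 * d k l)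
      + (\<Sum>k\<in>K. \<Sum>l\<in>K. (t l)\<^sup>2 * d l k)) / 2 - (\<Sum>k\<in>K. (t k)\<^sup>2)"
    using fin by (simp add: sum.distrib sum_subtractf sum_divide_distrib[symmetric])
  also have "(\<Sum>k\<in>K. \<Sum>l\<in>K. (t l)\<^sup>2 * d l k) = (\<Sum>k\<in>K. \<Sum>l\<in>K. (t k)\<^sup>2 * d k l)"
    by (rule sum.swap)
  also have "(\<Sum>k\<in>K. \<Sum>l\<in>K. t k * t l) = (\<Sum>k\<in>K. t k)\<^sup>2"
    by (simp add: power2_eq_square sum_product)
  finally show ?thesis using sq by simp
qed

lemma sum_strict_pairs:
  fixes g :: "nat \<Rightarrow> nat \<Rightarrow> real"
  assumes sym: "\<And>r s. g r s = g s r" and diag: "\<And>r. g r r = 0"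
  shows "2 * (\<Sum>(r, s)\<in>{(r, s). 1 \<le> r \<and> r < s \<and> s \<le> m}. g r s) = (\<Sum>r=1..m. \<Sum>s=1..m. g r s)"
proof -
  let ?L = "{(r, s). 1 \<le> r \<and> r < s \<and> s \<le> m}" and ?G = "{(r, s). 1 \<le> s \<and> s < r \<and> r \<le> m}"
  have fin: "finite ?L" "finite ?G"
    by (rule finite_subset[of _ "{1..m} \<times> {1..m}"]; auto)+
  have "(\<Sum>r=1..m. \<Sum>s=1..m. g r s) = (\<Sum>(r, s)\<in>{1..m} \<times> {1..m}. g r s)"
    by (simp add: sum.cartesian_product)
  also have "\<dots> = (\<Sum>(r, s)\<in>?L \<union> ?G. g r s)"
    by (rule sum.mono_neutral_right) (auto simp: diag not_less intro: le_neq_implies_less)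
  also have "\<dots> = (\<Sum>(r, s)\<in>?L. g r s) + (\<Sum>(r, s)\<in>?G. g r s)"
    by (rule sum.union_disjoint) (use fin in auto)
  also have "(\<Sum>(r, s)\<in>?G. g r s) = (\<Sum>(r, s)\<in>?L. g r s)"
    by (rule sum.reindex_bij_witness[of _ prod.swap prod.swap]) (auto simp: sym)
  finally show ?thesis by simp
qed

theorem mainTheorem2:
  fixes A :: "nat \<Rightarrow> real ^ 'n ^ 'n" and m :: nat
  assumes "CARD('n) \<ge> 2"
    and "m \<ge> 2"
    and "\<And>r. r \<in> {1..m} \<Longrightarrow> transpose (A r) = A r"
  shows "(\<Sum>r = 1..m. (hs_norm (A r))\<^sup>2)\<^sup>2
           \<ge> 2 * (\<Sum>(r, s) \<in> {(r, s). 1 \<le> r \<and> r < s \<and> s \<le> m}. (hs_norm (commutator (A r) (A s)))\<^sup>2)"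
proof -
  let ?R = "{1..m}"
  obtain K t where K: "finite K" "orthonormal K" and sub: "K \<subseteq> span (A ` ?R)"
    and span: "\<forall>r\<in>?R. A r \<in> span K" and t0: "\<forall>k. 0 \<le> t k"
    and gram: "\<forall>k\<in>K. \<forall>l\<in>K. (\<Sum>r\<in>?R. (A r \<bullet> k) * (A r \<bullet> l)) = (if k = l then t k else 0)"
    by (rule principal_axes[OF finite_atLeastAtMost])
  have image: "(\<Sum>r\<in>?R. (norm (f (A r)))\<^sup>2) = (\<Sum>k\<in>K. t k * (norm (f k))\<^sup>2)"
    if "linear f" for f :: "real ^ 'n ^ 'n \<Rightarrow> real ^ 'n ^ 'n"
    by (rule sum_norm_sq_linear_image[OF K(2,1) _ _ that])
       (simp_all only: bspec[OF span] bspec[OF bspec[OF gram]])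
  define c where "c k l = (norm (commutator k l))\<^sup>2" for k l :: "real ^ 'n ^ 'n"
  have c_sym: "c k l = c l k" for k l by (simp add: c_def norm_commutator_swap[of k])
  have "subspace {X :: real ^ 'n ^ 'n. transpose X = X}"
    by (auto simp: subspace_def transpose_def vec_eq_iff)
  then have "span (A ` ?R) \<subseteq> {X. transpose X = X}"
    by (intro span_minimal) (use assms(3) in auto)
  with sub have symK: "\<And>k. k \<in> K \<Longrightarrow> transpose k = k" by auto
  have row: "(\<Sum>l\<in>S. c k l) \<le> real (card S) + 1" if "k \<in> K" "S \<subseteq> K" for k S
    unfolding c_def using that K symK
    by (intro sum_norm_sq_commutator_le)
       (auto intro: orthonormal_norm finite_subset orthonormal_subset)
  have "2 * (\<Sum>(r, s)\<in>{(r, s). 1 \<le> r \<and> r < s \<and> s \<le> m}. c (A r) (A s))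
      = (\<Sum>r\<in>?R. \<Sum>s\<in>?R. c (A r) (A s))"
    by (rule sum_strict_pairs) (rule c_sym, simp add: c_def commutator_self)
  also have "\<dots> = (\<Sum>s\<in>?R. \<Sum>k\<in>K. t k * c k (A s))"
    by (subst sum.swap) (simp only: c_def image[OF linear_commutator_left])
  also have "\<dots> = (\<Sum>k\<in>K. t k * (\<Sum>s\<in>?R. c (A s) k))"
    by (subst sum.swap) (simp add: sum_distrib_left c_sym)
  also have "\<dots> = (\<Sum>k\<in>K. \<Sum>l\<in>K. t k * t l * c k l)"
    unfolding c_def image[OF linear_commutator_left]
    by (simp add: sum_distrib_left mult.assoc norm_commutator_swap)
  also have "\<dots> \<le> (\<Sum>k\<in>K. t k)\<^sup>2"
    by (rule weighted_sum_le_square) (use K t0 c_sym row in \<open>auto simp: c_def commutator_self\<close>)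
  also have "(\<Sum>k\<in>K. t k) = (\<Sum>r\<in>?R. (norm (A r))\<^sup>2)"
    using image[OF linear_id] by (simp add: orthonormal_norm[OF K(2)])
  finally show ?thesis by (simp add: hs_norm_eq_norm c_def)
qed

end
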